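(* Let $p=2^{s+1}r+3$ be a prime with $s\in\{0,1\}$ and either $r=1$ or $r$ an odd prime such that $2$ is a primitive root modulo $r$. Let $(d_n)_{n\ge 0}$ be the $(p-3)/2$-periodic binary sequence of parities of differences of consecutive quadratic residues modulo $p$ (defined in the context). Then the linear complexity of $(d_n)$ over $\mathbb{F}_2$ is maximal, $$L(d_n)=\frac{p-3}{2}.$$
   Context: For a prime $p\ge 5$, let $q_0,q_1,\ldots,q_{(p-3)/2}$ be the (nonzero) quadratic residues modulo $p$, represented as integers in increasing order, $1=q_0<q_1<\cdots<q_{(p-3)/2}\le p-1$. The sequence $(d_n)_{n\ge 0}$ with values in $\{0,1\}=\mathbb{F}_2$ is defined by $d_n = (q_n+q_{n+1}) \bmod 2$ (sum of integers, reduced modulo $2$) for $n=0,1,\ldots,(p-5)/2$, and $d_{n+(p-3)/2}=d_n$ for all $n\ge 0$. The linear complexity $L(s_n)$ of a sequence $(s_n)_{n\ge0}$ over $\mathbb{F}_2$ is the length $L$ of the shortest linear recurrence $s_{n+L}=c_{L-1}s_{n+L-1}+\cdots+c_0s_n$, $n=0,1,\ldots$, with coefficients $c_0,\ldots,c_{L-1}\in\mathbb{F}_2$, satisfied by the sequence. *)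

theory Defs
  imports "HOL-Number_Theory.Number_Theory" "HOL-Library.Z2"
begin

definition quad_residues :: "nat \<Rightarrow> nat set" where
  "quad_residues p = {a \<in> {1..p - 1}. QuadRes (int p) (int a)}"

definition nth_residue :: "nat \<Rightarrow> nat \<Rightarrow> nat" where
  "nth_residue p n = sorted_list_of_set (quad_residues p) ! n"

text \<open>
  Reducing the index modulo \<open>(p - 3) div 2\<close> is the periodic continuation of
  \<open>d\<^sub>0, \<dots>, d\<^bsub>(p-5)/2\<^esub>\<close>. The map \<^const>\<open>of_nat\<close> into the field \<^typ>\<open>bit\<close> is
  reduction modulo 2.
\<close>

definition parity_seq :: "nat \<Rightarrow> nat \<Rightarrow> bit" where
  "parity_seq p n =
     (let m = n mod ((p - 3) div 2)
      in of_nat (nth_residue p m + nth_residue p (m + 1)))"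

text \<open>
  The empty recurrence (\<open>L = 0\<close>) says that the sequence is zero. The value is meaningful only
  for sequences that satisfy some linear recurrence, as every periodic sequence does.
\<close>

definition linear_complexity :: "(nat \<Rightarrow> bit) \<Rightarrow> nat" where
  "linear_complexity s =
     (LEAST L. \<exists>c :: nat \<Rightarrow> bit. \<forall>n. s (n + L) = (\<Sum>i<L. c i * s (n + i)))"

end

theory Submission
  imports Defs "HOL-Computational_Algebra.Polynomial_Factorial"
begin

text \<open>
  Let \<open>N = (p - 3) div 2 = m * r\<close> with \<open>m = 2 ^ s\<close>, a period of the sequence \<open>d\<close>. Polynomials over
  the two-element field act on sequences with \<open>x\<close> as the shift, and a linear recurrence is a monic
  annihilator of \<open>d\<close>. If one existed of degree below \<open>N\<close>, then a proper divisor of \<open>x ^ N - 1\<close>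
  would annihilate \<open>d\<close> (\<open>annihilator_of_degree_le_dvd\<close>). Write \<open>G = 1 + x + \<dots> + x ^ (r - 1)\<close>.
  In characteristic 2, \<open>x ^ N - 1 = ((x - 1) * G) ^ m\<close>, and \<open>G\<close> is irreducible (or 1, if
  \<open>r = 1\<close>) because 2 is a primitive root modulo \<open>r\<close> (\<open>irreducible_geom_poly\<close>). So \<open>d\<close> would be
  annihilated by \<open>(x ^ N - 1) / (x - 1)\<close> or, for \<open>r \<noteq> 1\<close>, by \<open>(x ^ N - 1) / G\<close>.

  The first polynomial maps \<open>d\<close> to the sum of \<open>d\<close> over a period. This sum telescopes to the parity
  of the smallest residue 1 plus the largest residue. The largest residue is even: it is \<open>p - 1\<close>
  if \<open>p mod 4 = 1\<close>, and otherwise \<open>p mod 8 = 7\<close> and it is \<open>p - q\<close>, where \<open>q\<close> is the least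
  nonresidue, which is odd because 2 is a residue. So the sum is 1.

  If the second polynomial annihilates \<open>d\<close>, then \<open>\<Sum>j<m. d (n + j * r)\<close> does not depend on \<open>n\<close>;
  since the whole period sums to 1, it is 1 for every \<open>n\<close>, and for \<open>m \<le> 2\<close> exactly \<open>r\<close> of the
  \<open>N\<close> terms of a period are 1 (\<open>linear_complexity_eq_period_primroot\<close>). It remains to see that this
  count is wrong.

  For \<open>m = 1\<close> it would mean that all terms are 1, but some consecutive residues differ by 2
  (\<open>ex_residue_gap_2\<close>). For \<open>m = 2\<close>, \<open>p = 4 * r + 3\<close> and precisely \<open>r\<close> pairs of
  consecutive residues differ by 1 (\<open>card_consecutive_residues\<close>), each giving a term 1; a
  further term 1 comes from a gap of odd length at least 3 (\<open>ex_odd_residue_gap\<close>). Such a gap is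
  sought around \<open>2 * q\<close>, where the characters of most numbers are known because 2 and
  all numbers below \<open>q\<close> are residues; it may appear as a run of residues between two nonresidues,
  and then reflection at \<open>p\<close> turns it into a gap.
\<close>

section \<open>Polynomials acting on sequences by shifts\<close>

definition shift_act :: "'a::comm_ring_1 poly \<Rightarrow> (nat \<Rightarrow> 'a) \<Rightarrow> nat \<Rightarrow> 'a" where
  "shift_act f t n = (\<Sum>i\<le>degree f. coeff f i * t (n + i))"

lemma shift_act_eq_sum:
  "degree f \<le> m \<Longrightarrow> shift_act f t n = (\<Sum>i\<le>m. coeff f i * t (n + i))"
  unfolding shift_act_def by (rule sum.mono_neutral_left) (auto simp: coeff_eq_0)

lemma shift_act_0 [simp]: "shift_act 0 t n = 0"
  by (simp add: shift_act_def)

lemma shift_act_zero_seq [simp]: "shift_act f (\<lambda>_. 0) n = 0"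
  by (simp add: shift_act_def)

lemma shift_act_add: "shift_act (f + g) t n = shift_act f t n + shift_act g t n"
  using shift_act_eq_sum[of f "max (degree f) (degree g)" t n]
    shift_act_eq_sum[of g "max (degree f) (degree g)" t n]
    shift_act_eq_sum[OF degree_add_le_max, of f g t n]
  by (simp add: algebra_simps sum.distrib)

lemma shift_act_smult: "shift_act (smult a f) t n = a * shift_act f t n"
  using shift_act_eq_sum[of "smult a f" "degree f" t n, OF degree_smult_le]
  by (simp add: shift_act_def sum_distrib_left mult.assoc)

lemma shift_act_diff: "shift_act (f - g) t n = shift_act f t n - shift_act g t n"
  using shift_act_add[of f "- g" t n] shift_act_smult[of "-1" g t n] by simp

lemma shift_act_pCons: "shift_act (pCons a f) t n = a * t n + shift_act f t (Suc n)"
proof -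
  have "shift_act (pCons a f) t n = (\<Sum>i\<le>Suc (degree f). coeff (pCons a f) i * t (n + i))"
    by (rule shift_act_eq_sum) (rule degree_pCons_le)
  then show ?thesis
    unfolding sum.atMost_Suc_shift by (simp add: shift_act_def)
qed

lemma shift_act_mult: "shift_act (f * g) t n = shift_act f (shift_act g t) n"
  by (induction f arbitrary: n) (simp_all add: shift_act_add shift_act_smult shift_act_pCons)

lemma shift_act_1 [simp]: "shift_act 1 t n = t n"
  by (simp add: one_pCons shift_act_pCons)

lemma shift_act_monom: "shift_act (monom c k) t n = c * t (n + k)"
  by (induction k arbitrary: n) (simp_all add: monom_0 monom_Suc shift_act_pCons)

lemma shift_act_sum: "shift_act (\<Sum>i\<in>A. f i) t n = (\<Sum>i\<in>A. shift_act (f i) t n)"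
  by (induction A rule: infinite_finite_induct) (simp_all add: shift_act_add)

text \<open>
  The annihilators of a sequence form an ideal, and \<open>g\<close> is a generator: a nonzero annihilator of
  least degree divides all others, since the remainders are annihilators too.
\<close>
lemma annihilator_of_degree_le_dvd:
  fixes f C :: "'a::field poly"
  assumes "C \<noteq> 0" "\<And>n. shift_act C t n = 0" "\<And>n. shift_act f t n = 0"
  obtains g where "g dvd f" "g \<noteq> 0" "degree g \<le> degree C" "\<And>n. shift_act g t n = 0"
proof -
  define P where "P = (\<lambda>h. h \<noteq> 0 \<and> (\<forall>n. shift_act h t n = 0))"
  define g where "g = arg_min degree P"
  have g: "P g" and min: "\<And>h. P h \<Longrightarrow> degree g \<le> degree h"
    using arg_min_nat_lemma[of P C degree] assms by (auto simp: P_def g_def)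
  have "shift_act (f mod g) t n = 0" for n
  proof -
    have "shift_act g t = (\<lambda>_. 0)"
      using g by (auto simp: P_def)
    then have "shift_act (f div g * g) t n = 0"
      by (simp add: shift_act_mult)
    then show ?thesis
      using assms(3)[of n] shift_act_add[of "f div g * g" "f mod g" t n] by simp
  qed
  then have "f mod g = 0"
    using min[of "f mod g"] degree_mod_less[of g f] g by (force simp: P_def)
  with g assms min show thesis
    by (intro that[of g]) (auto simp: P_def mod_eq_0_iff_dvd)
qed

lemma degree_monom_minus_1: "N > 0 \<Longrightarrow> degree (monom 1 N - 1 :: 'a::comm_ring_1 poly) = N"
  using degree_add_eq_left[of "-1" "monom (1::'a) N"] by (simp add: degree_monom_eq)

text \<open>
  A recurrence shorter than the period \<open>N\<close> yields an annihilator that divides \<open>x ^ N - 1\<close> and has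
  smaller degree, so its cofactor is not a unit. The hypothesis \<open>cofactor\<close> excludes this.
\<close>
lemma linear_complexity_eq_period:
  assumes N: "N > 0" and period: "\<And>n. s (n + N) = s n"
    and cofactor: "\<And>g k. monom 1 N - 1 = g * k \<Longrightarrow> (\<And>n. shift_act g s n = 0) \<Longrightarrow> is_unit k"
  shows "linear_complexity s = N"
  unfolding linear_complexity_def
proof (rule Least_equality)
  have "s (n + N) = (\<Sum>i<N. (if i = 0 then 1 else 0) * s (n + i))" for n
  proof -
    have "(\<Sum>i<N. (if i = 0 then 1 else 0) * s (n + i)) = (\<Sum>i<N. if i = 0 then s (n + i) else 0)"
      by (intro sum.cong) auto
    also have "\<dots> = s n"
      using sum.delta[of "{..<N}" 0 "\<lambda>i. s (n + i)"] N by simp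
    finally show ?thesis by (simp add: period)
  qed
  then show "\<exists>c. \<forall>n. s (n + N) = (\<Sum>i<N. c i * s (n + i))"
    by (intro exI[of _ "\<lambda>i. if i = 0 then 1 else 0"]) blast
next
  fix L assume "\<exists>c. \<forall>n. s (n + L) = (\<Sum>i<L. c i * s (n + i))"
  then obtain c where c: "\<And>n. s (n + L) = (\<Sum>i<L. c i * s (n + i))"
    by blast
  define C where "C = monom 1 L - (\<Sum>i<L. monom (c i) i)"
  have coeff_L: "coeff C L = 1"
    by (simp add: C_def coeff_sum)
  then have "C \<noteq> 0"
    by (metis coeff_0 zero_neq_one)
  moreover have "shift_act C s n = 0" for n
    unfolding C_def shift_act_diff shift_act_sum shift_act_monom
    by (simp only: c[of n]) simp
  moreover have "shift_act (monom 1 N - 1) s n = 0" for n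
    unfolding shift_act_diff shift_act_monom by (simp add: period)
  ultimately obtain g where g: "g dvd monom 1 N - 1" "g \<noteq> 0" "degree g \<le> degree C"
      "\<And>n. shift_act g s n = 0"
    using annihilator_of_degree_le_dvd by metis
  then obtain k where k: "monom 1 N - 1 = g * k"
    by blast
  have "is_unit k"
    using cofactor[OF k g(4)] .
  have "degree (monom 1 N - 1 :: bit poly) = N"
    using N by (rule degree_monom_minus_1)
  moreover have "degree C \<le> L"
    unfolding C_def
    by (intro degree_diff_le degree_sum_le) (auto intro: degree_monom_le order.trans[OF degree_monom_le])
  moreover have "degree (g * k) = degree g"
    using \<open>is_unit k\<close> g(2) by (auto simp: is_unit_poly_iff)
  ultimately show "N \<le> L"
    using k g(3) by simp
qed

section \<open>Irreducibility of the polynomial 1 + x + ... + x^(r-1) over the field with two elements\<close>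

lemma of_nat_bit: "(of_nat n :: bit) = of_bool (odd n)"
  by (induction n) auto

definition geom_poly :: "nat \<Rightarrow> bit poly" where
  "geom_poly n = (\<Sum>i<n. monom 1 i)"

lemma geom_poly_mult: "geom_poly n * (monom 1 1 - 1) = monom 1 n - 1"
  by (induction n) (simp_all add: geom_poly_def mult_monom algebra_simps)

lemma poly_bit_2 [simp]: "(2 :: bit poly) = 0"
  by (simp add: numeral_poly)

lemma poly_bit_double [simp]: "f + f = (0 :: bit poly)"
  by (simp flip: mult_2)

lemma poly_bit_minus: "f - g = f + (g :: bit poly)"
  by (simp add: poly_eq_iff)

lemma square_sum_bit_poly: "(\<Sum>i\<in>A. f i)\<^sup>2 = (\<Sum>i\<in>A. (f i :: bit poly)\<^sup>2)"
proof (induction A rule: infinite_finite_induct)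
  case (insert x A)
  have "(a + b)\<^sup>2 = a\<^sup>2 + b\<^sup>2 + (a * b + a * b)" for a b :: "bit poly"
    by (simp only: power2_eq_square distrib_left distrib_right mult.commute[of b a] ac_simps)
  then show ?case using insert by simp
qed simp_all

text \<open>
  Squaring is additive in characteristic 2 and fixes the coefficients 0 and 1.
\<close>
lemma frobenius_bit_poly:
  fixes f :: "bit poly"
  assumes "degree f \<le> m"
  shows "f ^ (2 ^ j) = (\<Sum>i\<le>m. monom (coeff f i) (i * 2 ^ j))"
proof (induction j)
  case 0
  then show ?case using poly_as_sum_of_monoms'[OF assms] by simp
next
  case (Suc j)
  have "f ^ (2 ^ Suc j) = (f ^ (2 ^ j))\<^sup>2"
    by (simp add: power_mult[symmetric] mult.commute)
  also have "\<dots> = (\<Sum>i\<le>m. monom (coeff f i) (i * 2 ^ Suc j))"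
    unfolding Suc square_sum_bit_poly
    by (intro sum.cong refl) (simp add: monom_power ac_simps)
  finally show ?case .
qed

lemma smult_sum_right: "smult a (\<Sum>i\<in>A. f i) = (\<Sum>i\<in>A. smult a (f i))"
  by (induction A rule: infinite_finite_induct) (simp_all add: smult_add_right)

text \<open>
  Modulo \<open>geom_poly r\<close> the \<open>r\<close>-th power of \<open>x\<close> is 1.
\<close>
lemma geom_poly_dvd_monom_cong:
  assumes "i mod r = j mod r"
  shows "geom_poly r dvd monom 1 i - monom 1 j"
proof -
  have *: "geom_poly r dvd monom 1 i - monom 1 (i mod r)" for i
  proof -
    have "monom 1 i - monom 1 (i mod r) = monom 1 (i mod r) * (monom 1 r ^ (i div r) - 1 :: bit poly)"
      by (simp add: algebra_simps monom_power mult_monom)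
    also have "monom 1 r ^ (i div r) - 1 = (monom 1 r - 1) * (\<Sum>k<i div r. (monom 1 r :: bit poly) ^ k)"
      by (rule power_diff_1_eq)
    finally show ?thesis
      by (metis dvd_mult dvd_mult2 dvd_triv_left geom_poly_mult)
  qed
  have "monom 1 i - monom 1 j = (monom 1 i - monom 1 (i mod r)) - (monom 1 j - monom 1 (j mod r) :: bit poly)"
    using assms by simp
  then show ?thesis
    using dvd_diff[OF *[of i] *[of j]] by simp
qed

text \<open>
  The exponents \<open>i * 2 ^ j\<close> with \<open>j < r - 1\<close> run once through the nonzero classes modulo \<open>r\<close>, so
  modulo \<open>geom_poly r\<close> their powers of \<open>x\<close> add up to \<open>x + \<dots> + x ^ (r - 1)\<close>.
\<close>
lemma primroot_2_orbit_sum: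
  assumes r: "prime r" "residue_primroot r 2" and i: "0 < i" "i < r"
  shows "geom_poly r dvd (\<Sum>j<r - 1. monom 1 (i * 2 ^ j)) - (geom_poly r - 1)"
proof -
  have r1: "r > 1" using r(1) prime_gt_1_nat by blast
  have "bij_betw (\<lambda>j. 2 ^ j mod r) {..<r - 1} {0<..<r}"
    using residue_primroot_is_generator[OF r1 r(2)] r(1)
    by (simp add: totient_prime totatives_prime)
  moreover have "bij_betw (\<lambda>x. i * x mod r) {0<..<r} {0<..<r}"
  proof -
    have "inj_on (\<lambda>x. i * x mod r) {0<..<r}"
    proof (rule inj_onI)
      fix x y assume "x \<in> {0<..<r}" "y \<in> {0<..<r}" "i * x mod r = i * y mod r"
      moreover have "coprime i r"
        using i r(1) by (metis coprime_commute nat_dvd_not_less prime_imp_coprime)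
      ultimately show "x = y"
        by (metis cong_def cong_mult_lcancel_nat greaterThanLessThan_iff mod_less)
    qed
    moreover have "(\<lambda>x. i * x mod r) ` {0<..<r} \<subseteq> {0<..<r}"
      using i r(1) r1 by (auto simp: prime_dvd_mult_iff mod_greater_zero_iff_not_dvd dest: nat_dvd_not_less)
    ultimately show ?thesis
      by (simp add: bij_betw_def endo_inj_surj)
  qed
  ultimately have bij: "bij_betw (\<lambda>j. i * 2 ^ j mod r) {..<r - 1} {0<..<r}"
    using bij_betw_trans by (force simp: o_def mod_mult_right_eq)
  have "geom_poly r - 1 = (\<Sum>k\<in>{0<..<r}. monom 1 k)"
  proof -
    have "{..<r} = insert 0 {0<..<r}" using r1 by auto
    then show ?thesis by (simp add: geom_poly_def)
  qed
  also have "\<dots> = (\<Sum>j<r - 1. monom 1 (i * 2 ^ j mod r))"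
    using sum.reindex_bij_betw[OF bij, of "monom 1"] by (rule sym)
  finally have "(\<Sum>j<r - 1. monom 1 (i * 2 ^ j)) - (geom_poly r - 1)
      = (\<Sum>j<r - 1. monom 1 (i * 2 ^ j) - monom 1 (i * 2 ^ j mod r))"
    by (simp add: sum_subtractf)
  then show ?thesis
    by (auto intro!: dvd_sum geom_poly_dvd_monom_cong)
qed

text \<open>
  This is a trace argument. For \<open>f\<close> of degree below \<open>r\<close> without constant term, the sum of \<open>f ^ (2 ^ j)\<close>
  over \<open>j < r - 1\<close> is, by Frobenius and the orbit sums, congruent to the constant \<open>f(1)\<close> modulo
  \<open>geom_poly r\<close>. A divisor \<open>g\<close> of \<open>geom_poly r\<close> of degree below \<open>r - 1\<close> divides this sum for
  \<open>f = x * g\<close>, hence it divides the constant \<open>g(1)\<close>. As \<open>geom_poly r\<close> has the value 1 at 1, so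
  has \<open>g\<close>; thus \<open>g\<close> is a unit.
\<close>
lemma irreducible_geom_poly:
  assumes r: "prime r" "odd r" "residue_primroot r 2"
  shows "irreducible (geom_poly r)"
proof -
  have r3: "r \<ge> 3"
    using r prime_ge_2_nat[of r] by (cases "r = 2") auto
  have deg: "degree (geom_poly r) = r - 1"
  proof -
    have "degree (geom_poly r * (monom 1 1 - 1)) = r" "degree (monom 1 1 - 1 :: bit poly) = 1"
      unfolding geom_poly_mult using r3
      by (simp_all add: degree_monom_minus_1)
    moreover from this have "geom_poly r \<noteq> 0" "(monom 1 1 - 1 :: bit poly) \<noteq> 0"
      using r3 by (metis degree_0 mult_zero_left not_numeral_le_zero, metis degree_0 zero_neq_one)
    ultimately show ?thesis
      by (simp add: degree_mult_eq)
  qed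
  have value1: "poly (geom_poly r) 1 = 1"
    using r(2) by (simp add: geom_poly_def poly_sum poly_monom of_nat_bit)
  have unit: "is_unit g" if g: "g dvd geom_poly r" "degree g < r - 1" for g
  proof -
    define f where "f = pCons 0 g"
    have degf: "degree f \<le> r - 1"
      using g(2) by (auto simp: f_def intro: order.trans[OF degree_pCons_le])
    \<comment> \<open>Modulo an irreducible \<open>geom_poly r\<close> this is the trace of \<open>f\<close> to the two-element field.\<close>
    define T where "T = (\<Sum>j<r - 1. f ^ (2 ^ j))"
    have "T = (\<Sum>j<r - 1. \<Sum>i\<le>r - 1. monom (coeff f i) (i * 2 ^ j))"
      unfolding T_def using frobenius_bit_poly[OF degf] by simp
    also have "\<dots> = (\<Sum>i\<le>r - 1. \<Sum>j<r - 1. monom (coeff f i) (i * 2 ^ j))"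
      by (rule sum.swap)
    also have "\<dots> = (\<Sum>i\<le>r - 1. smult (coeff f i) (\<Sum>j<r - 1. monom 1 (i * 2 ^ j)))"
    proof -
      have "monom c k = smult c (monom 1 k)" for c :: bit and k
        by (cases c) simp_all
      then show ?thesis by (metis (no_types, lifting) smult_sum_right sum.cong)
    qed
    finally have "T - (\<Sum>i\<le>r - 1. smult (coeff f i) (geom_poly r - 1)) =
        (\<Sum>i\<le>r - 1. smult (coeff f i) ((\<Sum>j<r - 1. monom 1 (i * 2 ^ j)) - (geom_poly r - 1)))"
      by (simp only: smult_diff_right sum_subtractf)
    also have "geom_poly r dvd \<dots>"
    proof (intro dvd_sum)
      fix i assume "i \<in> {..r - 1}"
      then show "geom_poly r dvd smult (coeff f i) ((\<Sum>j<r - 1. monom 1 (i * 2 ^ j)) - (geom_poly r - 1))"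
        using primroot_2_orbit_sum[OF r(1,3), of i] r3
        by (cases "i = 0") (auto simp: f_def intro: dvd_smult)
    qed
    also have "(\<Sum>i\<le>r - 1. smult (coeff f i) (geom_poly r - 1)) = smult (poly f 1) (geom_poly r - 1)"
    proof -
      have "poly f 1 = (\<Sum>i\<le>degree f. coeff f i)"
        by (simp only: poly_altdef power_one mult_1_right)
      also have "\<dots> = (\<Sum>i\<le>r - 1. coeff f i)"
        using degf by (intro sum.mono_neutral_left) (auto simp: coeff_eq_0)
      finally show ?thesis by (simp only: smult_sum)
    qed
    finally have "g dvd T - smult (poly f 1) (geom_poly r - 1)"
      using g(1) dvd_trans by blast
    moreover have "g dvd T"
    proof -
      have "f = [:0, 1:] * g" by (simp add: f_def)
      then have "g dvd f" by (metis dvd_triv_right)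
      then show ?thesis
        unfolding T_def by (intro dvd_sum) (auto intro: dvd_trans[OF _ dvd_power])
    qed
    ultimately have "g dvd smult (poly f 1) (geom_poly r - 1)"
      using dvd_diff_right_iff by blast
    moreover have "poly f 1 = 1"
    proof -
      obtain h where "geom_poly r = g * h" using g(1) by blast
      then show ?thesis
        using value1 by (cases "poly g 1") (auto simp: f_def)
    qed
    ultimately have "g dvd geom_poly r - 1"
      by simp
    then show ?thesis
      using g(1) dvd_diff_right_iff by blast
  qed
  show ?thesis
  proof (rule irreducibleI)
    show nz: "geom_poly r \<noteq> 0" using value1 by auto
    show "\<not> is_unit (geom_poly r)"
      using deg r3 is_unit_iff_degree[OF nz] by simp
    fix a b assume ab: "geom_poly r = a * b"
    with nz have "degree a + degree b = r - 1"
      using deg by (metis degree_mult_eq mult_eq_0_iff)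
    then consider "degree a < r - 1" | "degree b < r - 1"
      using r3 by linarith
    then show "is_unit a \<or> is_unit b"
      using unit ab by cases auto
  qed
qed

section \<open>Binary sequences of period r or 2r with maximal linear complexity\<close>

lemma dvd_mult_cancel_prime_elem:
  fixes p :: "'a::algebraic_semidom"
  assumes "prime_elem p" "\<not> p dvd k" "k dvd p * z"
  shows "k dvd z"
proof -
  obtain w where w: "p * z = k * w" using assms(3) by blast
  then have "p dvd w"
    using assms(1,2) by (metis dvd_triv_left prime_elem_dvd_mult_iff)
  then obtain v where "w = p * v" by blast
  then have "p * z = p * (k * v)" using w by (simp only: ac_simps)
  then have "z = k * v" using assms(1) by (metis mult_left_cancel prime_elem_def)
  then show ?thesis by simp
qed

lemma prime_elem_X_minus_1: "prime_elem (monom 1 1 - 1 :: bit poly)"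
proof (rule field_poly_irreducible_imp_prime, rule irreducibleI)
  let ?h = "monom 1 1 - 1 :: bit poly"
  have deg: "degree ?h = 1" by (rule degree_monom_minus_1) simp
  show nz: "?h \<noteq> 0" using deg by (metis degree_0 zero_neq_one)
  show "\<not> is_unit ?h" using deg is_unit_iff_degree[OF nz] by simp
  fix a b assume ab: "?h = a * b"
  then have ab0: "a \<noteq> 0" "b \<noteq> 0" using nz by (metis mult_zero_left, metis mult_zero_right)
  then have "degree a + degree b = 1"
    using deg ab by (metis degree_mult_eq)
  then have "degree a = 0 \<or> degree b = 0" by linarith
  then show "is_unit a \<or> is_unit b"
    using ab0 is_unit_iff_degree by blast
qed

text \<open>
  If neither prime divides \<open>k\<close>, all factors of the power can be cancelled one by one. A unit is
  admitted for \<open>q\<close> because \<open>geom_poly 1 = 1\<close>.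
\<close>
lemma nonunit_dvd_power_of_primes:
  fixes k :: "'a::algebraic_semidom"
  assumes "prime_elem p" "prime_elem q \<or> is_unit q" "k dvd (p * q) ^ m" "\<not> is_unit k"
  shows "p dvd k \<or> prime_elem q \<and> q dvd k"
proof (rule ccontr)
  assume contra: "\<not> ?thesis"
  from assms(3) have "is_unit k"
  proof (induction m)
    case (Suc m)
    then have "k dvd p * (q * (p * q) ^ m)"
      by (simp only: power_Suc mult.assoc)
    then have *: "k dvd q * (p * q) ^ m"
      using contra assms(1) by (metis dvd_mult_cancel_prime_elem)
    from assms(2) have "k dvd (p * q) ^ m"
    proof
      assume "prime_elem q"
      then show ?thesis using contra * dvd_mult_cancel_prime_elem by metis
    next
      assume "is_unit q"
      then show ?thesis using * dvd_mult_unit_iff' by metis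
    qed
    then show ?case by (rule Suc.IH)
  qed simp
  with assms(4) show False ..
qed

lemma monom_minus_1_power_bit:
  assumes "m = 1 \<or> m = 2"
  shows "monom 1 (m * r) - 1 = ((monom 1 1 - 1) * geom_poly r) ^ m"
proof -
  have "(f - 1)\<^sup>2 = f * f - 1" for f :: "bit poly"
  proof -
    have "(f - 1)\<^sup>2 = f * f - (f + f) + 1"
      by (simp only: power2_eq_square ring_distribs) simp
    also have "\<dots> = f * f - 1"
      by (simp only: poly_bit_double poly_bit_minus[of _ 1] diff_zero)
    finally show ?thesis .
  qed
  from this[of "monom 1 r"] have "(monom 1 r - 1 :: bit poly)\<^sup>2 = monom 1 (2 * r) - 1"
    by (simp only: mult_monom mult_2 mult_1)
  moreover have "(monom 1 1 - 1) * geom_poly r = monom 1 r - 1"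
    by (subst mult.commute) (rule geom_poly_mult)
  ultimately show ?thesis
    using assms by auto
qed

text \<open>
  Every proper divisor of \<open>x ^ (m * r) - 1\<close> divides its quotient by \<open>x - 1\<close> or, for \<open>r \<noteq> 1\<close>, by
  \<open>geom_poly r\<close>. The hypotheses \<open>sum1\<close> and \<open>ones\<close> prevent these from annihilating \<open>s\<close>: the first
  maps \<open>s\<close> to the sum over a period, and if the second annihilates \<open>s\<close>, then in each class modulo
  \<open>r\<close> exactly one term of a period is 1, provided that the sum over a period is 1.
\<close>
lemma linear_complexity_eq_period_primroot:
  assumes r: "r = 1 \<or> prime r \<and> odd r \<and> residue_primroot r 2"
    and m: "m = 1 \<or> m = 2"
    and period: "\<And>n. s (n + m * r) = s n"
    and sum1: "(\<Sum>n<m * r. s n) = 1"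
    and ones: "r \<noteq> 1 \<Longrightarrow> card {n. n < m * r \<and> s n = 1} \<noteq> r"
  shows "linear_complexity s = m * r"
proof (rule linear_complexity_eq_period)
  have r0: "r > 0" using r by (auto intro: prime_gt_0_nat)
  with m show pos: "m * r > 0" by auto
  show "s (n + m * r) = s n" for n by (rule period)
  let ?h = "monom 1 1 - 1 :: bit poly"
  fix g k assume gk: "monom 1 (m * r) - 1 = g * k" and g: "\<And>n. shift_act g s n = 0"
  have ann: "shift_act (g * f) s n = 0" for f n
  proof -
    have "shift_act g s = (\<lambda>_. 0)" using g by auto
    then show ?thesis unfolding mult.commute[of g] shift_act_mult by simp
  qed
  have cancel: "z = w" if "x * z = x * w" "x * z = monom 1 (m * r) - 1" for x z w :: "bit poly"
  proof -
    have "monom 1 (m * r) - 1 \<noteq> (0 :: bit poly)"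
      using degree_monom_minus_1[OF pos] pos by (metis degree_0 less_numeral_extra(3))
    with that show ?thesis by auto
  qed
  show "is_unit k"
  proof (rule ccontr)
    assume "\<not> is_unit k"
    have prime_geom: "r \<noteq> 1 \<Longrightarrow> prime_elem (geom_poly r)"
      using r irreducible_geom_poly field_poly_irreducible_imp_prime by blast
    have unit_geom: "r = 1 \<Longrightarrow> is_unit (geom_poly r)"
      by (simp add: geom_poly_def)
    have "?h dvd k \<or> prime_elem (geom_poly r) \<and> geom_poly r dvd k"
      using prime_geom unit_geom \<open>\<not> is_unit k\<close> gk monom_minus_1_power_bit[OF m, of r]
      by (intro nonunit_dvd_power_of_primes[OF prime_elem_X_minus_1, of "geom_poly r" k m]) auto
    then show False
    proof (elim disjE conjE)
      assume "?h dvd k"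
      then obtain f where "k = ?h * f" by blast
      then have "?h * (g * f) = ?h * geom_poly (m * r)"
        using gk geom_poly_mult[of "m * r"] by (simp only: ac_simps)
      then have "g * f = geom_poly (m * r)"
        using cancel[of ?h "geom_poly (m * r)" "g * f"] geom_poly_mult[of "m * r"]
        by (simp only: mult.commute[of ?h])
      then have "shift_act (geom_poly (m * r)) s 0 = 0"
        using ann[of f 0] by simp
      then have "(\<Sum>n<m * r. s n) = 0"
        by (simp only: geom_poly_def shift_act_sum shift_act_monom add_0 mult_1)
      with sum1 show False by simp
    next
      assume "prime_elem (geom_poly r)" "geom_poly r dvd k"
      then obtain f where "k = geom_poly r * f" by blast
      have "r \<noteq> 1" using \<open>prime_elem (geom_poly r)\<close> unit_geom by auto
      let ?w = "?h * (monom 1 r - 1) ^ (m - 1)"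
      have w: "geom_poly r * ?w = monom 1 (m * r) - 1"
      proof -
        have "(?h * geom_poly r) ^ m = (?h * geom_poly r) * (?h * geom_poly r) ^ (m - 1)"
          using m by (intro power_eq_if[THEN trans]) auto
        also have "\<dots> = geom_poly r * (?h * (geom_poly r * ?h) ^ (m - 1))"
          by (simp only: ac_simps)
        finally show ?thesis
          by (simp only: monom_minus_1_power_bit[OF m, of r] geom_poly_mult)
      qed
      then have "geom_poly r * (g * f) = geom_poly r * ?w"
        using gk \<open>k = _\<close> by (simp only: ac_simps)
      then have "g * f = ?w"
        using w by (metis cancel)
      then have w0: "shift_act ?w s n = 0" for n
        using ann[of f n] by simp
      \<comment> \<open>The quotient by \<open>geom_poly r\<close> is \<open>x - 1\<close> times \<open>\<Sum>j<m. x ^ (j * r)\<close>, which maps \<open>s\<close> to \<open>e\<close>.\<close>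
      define e where "e n = (\<Sum>j<m. s (n + j * r))" for n
      have "e (Suc n) = e n" for n
        using m
      proof
        assume "m = 1"
        then have "shift_act (monom 1 1 - 1) s n = 0"
          using w0[of n] by simp
        then have "s (Suc n) - s n = 0"
          by (simp only: shift_act_diff shift_act_monom shift_act_1 mult_1 Suc_eq_plus1)
        with \<open>m = 1\<close> show ?thesis
          by (simp only: e_def right_minus_eq) simp
      next
        assume "m = 2"
        then have "shift_act (?h * (monom 1 r - 1)) s n = 0"
          using w0[of n] by simp
        then have "(s (Suc n + r) - s (Suc n)) - (s (n + r) - s n) = 0"
          by (simp only: shift_act_mult shift_act_diff shift_act_monom shift_act_1 mult_1 Suc_eq_plus1)
        then have "s (Suc n) + s (Suc n + r) = s n + s (n + r)"
          by (cases "s n"; cases "s (n + r)"; cases "s (Suc n)"; cases "s (Suc n + r)") simp_all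
        with \<open>m = 2\<close> show ?thesis
          by (simp only: e_def numeral_2_eq_2 sum.lessThan_Suc lessThan_0 sum.empty mult_0 mult_1
              mult_Suc add_0 add_0_right)
      qed
      then have e_const: "e n = e 0" for n
        by (induction n) auto
      have "(\<Sum>n<m * r. s n) = (\<Sum>n<r. e n)"
      proof -
        have "(\<Sum>n<r. e n) = (\<Sum>j<m. \<Sum>n<r. s (n + j * r))"
          unfolding e_def by (rule sum.swap)
        also have "\<dots> = (\<Sum>j<m. sum s {j * r..<j * r + r})"
        proof (rule sum.cong[OF refl])
          fix j
          show "(\<Sum>n<r. s (n + j * r)) = sum s {j * r..<j * r + r}"
            using sum.shift_bounds_nat_ivl[of s 0 "j * r" r]
            by (simp only: add_0 atLeast0LessThan add.commute[of r])
        qed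
        also have "\<dots> = sum s {..<m * r}"
          by (rule sum.nat_group)
        finally show ?thesis by (rule sym)
      qed
      moreover have "(\<Sum>n<r. e n) = (\<Sum>n<r. e 0)"
        by (intro sum.cong refl e_const)
      ultimately have "(\<Sum>n<r. e 0) = 1"
        using sum1 by (simp only:)
      then have "e 0 = 1"
        by (cases "e 0") (simp_all only: sum.neutral_const zero_neq_one)
      then have e1: "e n = 1" for n using e_const[of n] by simp
      have "card {n. n < m * r \<and> s n = 1} = r"
        using m
      proof
        assume "m = 1"
        then have "{n. n < m * r \<and> s n = 1} = {..<r}"
          using e1 by (auto simp: e_def)
        then show ?thesis by simp
      next
        assume m2: "m = 2"
        have e2: "s (n + r) = 1 \<longleftrightarrow> s n \<noteq> 1" for n
          using e1[of n] m2 by (cases "s n"; cases "s (n + r)") (simp_all add: e_def numeral_2_eq_2)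
        let ?A = "{n. n < r \<and> s n = 1}" and ?B = "{n. n < r \<and> s n \<noteq> 1}"
        have "{n. n < m * r \<and> s n = 1} = ?A \<union> (\<lambda>n. n + r) ` ?B"
        proof (intro equalityI subsetI)
          fix n assume n: "n \<in> {n. n < m * r \<and> s n = 1}"
          show "n \<in> ?A \<union> (\<lambda>n. n + r) ` ?B"
          proof (cases "n < r")
            case False
            then obtain n' where n': "n = n' + r" by (metis le_add_diff_inverse2 not_less)
            then have "n' \<in> ?B" using n e2[of n'] m2 by simp
            with n' show ?thesis by blast
          qed (use n in simp)
        next
          fix n assume "n \<in> ?A \<union> (\<lambda>n. n + r) ` ?B"
          then show "n \<in> {n. n < m * r \<and> s n = 1}"
            using e2 m2 by auto
        qed
        moreover have "card (?A \<union> (\<lambda>n. n + r) ` ?B) = card ?A + card ?B"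
          by (subst card_Un_disjoint) (auto simp: card_image)
        moreover have "card ?A + card ?B = card {..<r}"
        proof -
          have "?A \<union> ?B = {..<r}" by auto
          moreover have "card (?A \<union> ?B) = card ?A + card ?B"
            by (rule card_Un_disjoint) auto
          ultimately show ?thesis by (simp only:)
        qed
        ultimately show ?thesis by simp
      qed
      with ones \<open>r \<noteq> 1\<close> show False by blast
    qed
  qed
qed

section \<open>Quadratic residues modulo an odd prime\<close>

lemma QuadRes_cong: "[a = b] (mod m) \<Longrightarrow> QuadRes m a \<longleftrightarrow> QuadRes m b"
  unfolding QuadRes_def by (meson cong_sym cong_trans)

locale odd_prime =
  fixes p :: nat
  assumes prime_p: "prime p" and p_gt_2: "p > 2"
begin

abbreviation R :: "nat \<Rightarrow> bool" where
  "R a \<equiv> QuadRes (int p) (int a)"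

lemma odd_p: "odd p"
  using prime_p p_gt_2 by (rule prime_odd_nat)

lemma Legendre_eq:
  assumes "\<not> int p dvd a"
  shows "Legendre a (int p) = (if QuadRes (int p) a then 1 else -1)"
  using assms by (simp add: Legendre_def cong_0_iff)

lemma sign_eq_of_cong:
  assumes "[x = y] (mod int p)" "x \<in> {1, -1}" "y \<in> {1, -1}"
  shows "x = y"
proof -
  have "\<not> [1 = - 1] (mod int p)" "\<not> [- 1 = 1] (mod int p)"
    using p_gt_2 by (auto simp: cong_iff_dvd_diff dest: zdvd_imp_le)
  then show ?thesis using assms by auto
qed

lemma QuadRes_mult:
  assumes "\<not> int p dvd a" "\<not> int p dvd b"
  shows "QuadRes (int p) (a * b) \<longleftrightarrow> (QuadRes (int p) a \<longleftrightarrow> QuadRes (int p) b)"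
proof -
  have ndvd: "\<not> int p dvd a * b"
    using assms prime_p by (simp add: prime_dvd_mult_iff)
  have "[Legendre (a * b) (int p) = Legendre a (int p) * Legendre b (int p)] (mod int p)"
    using cong_mult[OF euler_criterion[OF prime_p p_gt_2, of a] euler_criterion[OF prime_p p_gt_2, of b]]
      euler_criterion[OF prime_p p_gt_2, of "a * b"]
    by (metis cong_sym cong_trans power_mult_distrib)
  then have "Legendre (a * b) (int p) = Legendre a (int p) * Legendre b (int p)"
    by (rule sign_eq_of_cong) (auto simp: Legendre_eq assms ndvd)
  then show ?thesis
    by (simp add: Legendre_eq assms ndvd split: if_splits)
qed

lemma QuadRes_minus_1: "QuadRes (int p) (-1) \<longleftrightarrow> p mod 4 = 1"
proof -
  have ndvd: "\<not> int p dvd - 1"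
    using p_gt_2 by simp
  have "Legendre (- 1) (int p) \<in> {1, - 1}"
    by (simp only: Legendre_eq[OF ndvd]) simp
  then have "Legendre (- 1) (int p) = (- 1) ^ ((p - 1) div 2)"
    by (intro sign_eq_of_cong[OF euler_criterion[OF prime_p p_gt_2]])
      (auto simp: minus_one_power_iff)
  then have "QuadRes (int p) (-1) \<longleftrightarrow> even ((p - 1) div 2)"
    unfolding Legendre_eq[OF ndvd] by (simp add: minus_one_power_iff split: if_splits)
  also have "\<dots> \<longleftrightarrow> p mod 4 = 1"
    using odd_p by presburger
  finally show ?thesis .
qed

lemma not_dvd: "0 < a \<Longrightarrow> a < p \<Longrightarrow> \<not> p dvd a"
  by (simp add: nat_dvd_not_less)

lemma R_mult: "\<not> p dvd a \<Longrightarrow> \<not> p dvd b \<Longrightarrow> R (a * b) \<longleftrightarrow> (R a \<longleftrightarrow> R b)"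
  using QuadRes_mult[of "int a" "int b"] by simp

lemma R_cong: "[a = b] (mod p) \<Longrightarrow> R a \<longleftrightarrow> R b"
  using QuadRes_cong[of "int a" "int b" "int p"] by (simp add: cong_int_iff)

lemma R_square: "R (a * a)"
  unfolding QuadRes_def by (intro exI[of _ "int a"]) (simp add: power2_eq_square)

lemma R_1: "R 1"
  using R_square[of 1] by simp

lemma R_reflect:
  assumes "0 < a" "a < p"
  shows "R (p - a) \<longleftrightarrow> (R a \<longleftrightarrow> p mod 4 = 1)"
proof -
  have "[int (p - a) = (-1) * int a] (mod int p)"
    using assms by (simp add: cong_iff_dvd_diff of_nat_diff)
  then have "R (p - a) \<longleftrightarrow> QuadRes (int p) ((-1) * int a)"
    by (rule QuadRes_cong)
  also have "\<dots> \<longleftrightarrow> (p mod 4 = 1 \<longleftrightarrow> R a)"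
    using not_dvd[OF assms] p_gt_2 by (subst QuadRes_mult) (simp_all add: QuadRes_minus_1)
  finally show ?thesis by blast
qed

text \<open>
  By the lemma of Gauss it suffices to count the numbers \<open>x \<le> (p - 1) div 2\<close> with
  \<open>2 * x > (p - 1) div 2\<close>. For \<open>p = 8 * k + 7\<close> there are \<open>2 * k + 2\<close> of them, an even number.
\<close>
lemma R_2:
  assumes "p mod 8 = 7"
  shows "R 2"
proof -
  obtain k where k: "p = 8 * k + 7"
    using assms by (metis mult_div_mod_eq)
  interpret G: GAUSS p 2
    using prime_p p_gt_2 by unfold_locales (auto simp: cong_0_iff dest: zdvd_imp_le)
  have half: "(int p - 1) div 2 = 4 * int k + 3"
    by (simp add: k)
  have "G.E = (\<lambda>x. 2 * x) ` {2 * int k + 2..4 * int k + 3}"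
  proof (intro equalityI subsetI)
    fix y assume "y \<in> G.E"
    then obtain x where x: "0 < x" "x \<le> 4 * int k + 3" "y = x * 2 mod int p" "4 * int k + 3 < y"
      by (auto simp: G.E_def G.C_def G.B_def G.A_def half)
    then have "y = 2 * x" by (simp add: k)
    with x show "y \<in> (\<lambda>x. 2 * x) ` {2 * int k + 2..4 * int k + 3}"
      by (intro image_eqI[of _ _ x]) simp_all
  next
    fix y assume "y \<in> (\<lambda>x. 2 * x) ` {2 * int k + 2..4 * int k + 3}"
    then obtain x where x: "2 * int k + 2 \<le> x" "x \<le> 4 * int k + 3" "y = 2 * x" by auto
    then have "y = x * 2 mod int p" by (simp add: k)
    with x show "y \<in> G.E"
      unfolding G.E_def G.C_def G.B_def G.A_def half
      by (intro IntI image_eqI[of _ _ "x * 2"] image_eqI[of _ _ x]) simp_all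
  qed
  then have "card G.E = 2 * k + 2"
    by (simp add: card_image inj_on_def)
  then have "Legendre 2 (int p) = 1"
    using G.gauss_lemma by simp
  then show ?thesis
    by (simp add: Legendre_def split: if_splits)
qed

text \<open>
  Each residue has exactly one square root among \<open>1, \<dots>, (p - 1) div 2\<close>.
\<close>
lemma card_R: "card {a \<in> {1..p - 1}. R a} = (p - 1) div 2"
proof -
  let ?h = "(p - 1) div 2" and ?f = "\<lambda>x. x * x mod p"
  have "inj_on ?f {1..?h}"
  proof (rule inj_onI)
    have *: "x = y" if "x \<in> {1..?h}" "y \<in> {1..?h}" "?f x = ?f y" "x \<le> y" for x y
    proof (rule ccontr)
      assume "x \<noteq> y"
      have "p dvd y * y - x * x"
        using that by (metis mod_eq_dvd_iff_nat mult_le_mono)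
      also have "y * y - x * x = (y - x) * (y + x)"
      proof -
        obtain d where "y = x + d" using \<open>x \<le> y\<close> le_Suc_ex by blast
        then show ?thesis by (simp add: algebra_simps)
      qed
      finally have "p dvd y - x \<or> p dvd y + x"
        using prime_p by (simp add: prime_dvd_mult_iff)
      moreover have "0 < y - x" "y - x < p" "0 < y + x" "y + x < p"
        using that \<open>x \<noteq> y\<close> by auto
      ultimately show False using not_dvd[of "y - x"] not_dvd[of "y + x"] by blast
    qed
    fix x y assume "x \<in> {1..?h}" "y \<in> {1..?h}" "?f x = ?f y"
    then show "x = y" using *[of x y] *[of y x] by (cases "x \<le> y") auto
  qed
  moreover have "?f ` {1..?h} = {a \<in> {1..p - 1}. R a}"
  proof (intro equalityI subsetI)
    fix a assume "a \<in> ?f ` {1..?h}"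
    then obtain x where x: "1 \<le> x" "x \<le> ?h" "a = x * x mod p" by auto
    then have "\<not> p dvd x" by (intro not_dvd) auto
    then have "a > 0"
      using x prime_p by (simp add: prime_dvd_mult_iff mod_greater_zero_iff_not_dvd)
    moreover have "a < p" using x p_gt_2 by simp
    moreover have "R a"
      using R_square[of x] R_cong[of a "x * x"] x by simp
    ultimately show "a \<in> {a \<in> {1..p - 1}. R a}" by auto
  next
    fix a assume a: "a \<in> {a \<in> {1..p - 1}. R a}"
    then obtain y where "[y\<^sup>2 = int a] (mod int p)" unfolding QuadRes_def by auto
    define x where "x = nat (y mod int p)"
    have "int x = y mod int p" using p_gt_2 by (simp add: x_def)
    then have "[int x = y] (mod int p)" by simp
    then have "[(int x)\<^sup>2 = int a] (mod int p)"
      using cong_pow cong_trans \<open>[y\<^sup>2 = int a] (mod int p)\<close> by blast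
    then have xa: "[x * x = a] (mod p)"
      by (metis cong_int_iff of_nat_power power2_eq_square)
    have "x < p" using \<open>int x = _\<close> p_gt_2 by (metis of_nat_0_less_iff of_nat_less_iff pos_mod_bound gr_implies_not0 not_gr_zero)
    have "x \<noteq> 0"
    proof
      assume "x = 0"
      with xa have "p dvd a" by (simp add: cong_def mod_eq_0_iff_dvd)
      moreover have "0 < a" "a < p" using a p_gt_2 by auto
      ultimately show False using not_dvd[of a] by blast
    qed
    show "a \<in> ?f ` {1..?h}"
    proof (cases "x \<le> ?h")
      case True
      then show ?thesis using xa a \<open>x \<noteq> 0\<close> by (intro image_eqI[of _ _ x]) (auto simp: cong_def)
    next
      case False
      have "(int (p - x))\<^sup>2 = (int x)\<^sup>2 + int p * (int p - 2 * int x)"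
        using \<open>x < p\<close> by (simp add: of_nat_diff power2_eq_square algebra_simps)
      then have "[(int (p - x))\<^sup>2 = (int x)\<^sup>2] (mod int p)"
        by (simp add: cong_iff_dvd_diff)
      then have "[(p - x) * (p - x) = x * x] (mod p)"
        by (metis cong_int_iff of_nat_power power2_eq_square)
      then have "[(p - x) * (p - x) = a] (mod p)" using xa cong_trans by blast
      moreover have "p - x \<in> {1..?h}"
        using False \<open>x < p\<close> odd_p by (auto elim!: oddE)
      ultimately show ?thesis using a by (intro image_eqI[of _ _ "p - x"]) (auto simp: cong_def)
    qed
  qed
  ultimately show ?thesis
    using card_image by fastforce
qed

definition least_nonresidue :: nat where
  "least_nonresidue = (LEAST a. 0 < a \<and> \<not> R a)"

lemma least_nonresidue:
  shows least_nonresidue_pos: "0 < least_nonresidue"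
    and not_R_least: "\<not> R least_nonresidue"
    and least_nonresidue_less: "least_nonresidue < p"
    and R_below_least: "\<And>a. 0 < a \<Longrightarrow> a < least_nonresidue \<Longrightarrow> R a"
proof -
  have "\<exists>a. 0 < a \<and> a < p \<and> \<not> R a"
  proof (rule ccontr)
    assume "\<not> ?thesis"
    moreover have "a < p" if "a \<in> {1..p - 1}" for a
      using that p_gt_2 by auto
    ultimately have "{a \<in> {1..p - 1}. R a} = {1..p - 1}" by force
    then show False using card_R p_gt_2 by simp
  qed
  then obtain a where a: "0 < a" "a < p" "\<not> R a" by blast
  have *: "0 < least_nonresidue \<and> \<not> R least_nonresidue"
    unfolding least_nonresidue_def by (rule LeastI) (use a in simp)
  then show "0 < least_nonresidue" "\<not> R least_nonresidue" by auto
  have "least_nonresidue \<le> a"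
    unfolding least_nonresidue_def by (rule Least_le) (use a in simp)
  with a show "least_nonresidue < p" by simp
  show "R b" if "0 < b" "b < least_nonresidue" for b
    using not_less_Least[of b "\<lambda>a. 0 < a \<and> \<not> R a"] that by (auto simp: least_nonresidue_def)
qed

lemma least_nonresidue_ge_2: "least_nonresidue \<ge> 2"
  using not_R_least R_1 least_nonresidue_pos by (metis One_nat_def Suc_leI le_neq_implies_less numeral_2_eq_2)

lemma R_mult_less:
  assumes "0 < a" "a < p" "0 < b" "b < p"
  shows "R (a * b) \<longleftrightarrow> (R a \<longleftrightarrow> R b)"
  using assms not_dvd by (intro R_mult) auto

lemma odd_least_nonresidue:
  assumes "R 2"
  shows "odd least_nonresidue"
proof
  assume "even least_nonresidue"
  then obtain k where k: "least_nonresidue = 2 * k" by blast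
  then have "0 < k" "k < least_nonresidue" using least_nonresidue_pos by auto
  then have "R (2 * k)"
    using R_mult_less[of 2 k] assms R_below_least[of k] p_gt_2 least_nonresidue_less by auto
  with k not_R_least show False by simp
qed

lemma R_neighbours_of_least_nonresidue:
  assumes "R 2"
  shows "R (least_nonresidue - 1)" "R (least_nonresidue + 1)" "least_nonresidue + 1 < p"
proof -
  let ?q = "least_nonresidue"
  have q: "odd ?q" "2 \<le> ?q" "?q < p"
    using odd_least_nonresidue assms least_nonresidue_ge_2 least_nonresidue_less by auto
  show "R (?q - 1)" using q by (intro R_below_least) auto
  have "?q \<noteq> p - 1" using q(1) odd_p by auto
  with q show "?q + 1 < p" by simp
  have "even (?q + 1)" using q(1) by simp
  then obtain k where k: "?q + 1 = 2 * k" by blast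
  then have "R k" using q by (intro R_below_least) auto
  then show "R (?q + 1)"
    unfolding k using R_mult_less[of 2 k] assms p_gt_2 k q by auto
qed

text \<open>
  The multiple of \<open>q\<close> that follows \<open>p\<close> exceeds \<open>p\<close> by less than \<open>q\<close>, so it is a residue; its cofactor
  \<open>p div q + 1\<close> is then a nonresidue and therefore at least \<open>q\<close>.
\<close>
lemma least_nonresidue_bound: "least_nonresidue * (least_nonresidue - 1) \<le> p"
proof -
  let ?q = "least_nonresidue" and ?m = "p div least_nonresidue + 1"
  have q: "2 \<le> ?q" "?q < p" by (rule least_nonresidue_ge_2 least_nonresidue_less)+
  have "p mod ?q \<noteq> 0"
    using q prime_p by (metis dvd_eq_mod_eq_0 less_irrefl_nat numeral_le_one_iff prime_nat_iff semiring_norm(69))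
  moreover have "p mod ?q < ?q" using q by simp
  moreover have eq: "?q * ?m = p + (?q - p mod ?q)"
  proof -
    have "p mod ?q \<le> ?q" using q by (simp add: less_imp_le)
    moreover have "?q * ?m = ?q * (p div ?q) + ?q" by simp
    ultimately show ?thesis using mult_div_mod_eq[of ?q p] by linarith
  qed
  ultimately have "R (?q - p mod ?q)"
    by (intro R_below_least) auto
  moreover have "R (?q * ?m) \<longleftrightarrow> R (?q - p mod ?q)"
    by (rule R_cong) (simp only: eq cong_def mod_add_self1)
  ultimately have "R (?q * ?m)" by simp
  moreover have "?m < p"
    using q div_le_mono2[of 2 ?q p] p_gt_2 odd_p by auto
  ultimately have "\<not> R ?m"
    using R_mult_less[of ?q ?m] q not_R_least by simp
  then have "?q \<le> ?m"
    using R_below_least[of ?m] by force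
  then have "?q * (?q - 1) \<le> ?q * (p div ?q)" by (intro mult_le_mono2) linarith
  also have "\<dots> \<le> p" by simp
  finally show ?thesis .
qed

text \<open>
  For \<open>p mod 8 = 7\<close> reflection at \<open>p\<close> exchanges residues and nonresidues, so the greatest residue
  is the mirror image of the least nonresidue, which is odd because 2 is a residue.
\<close>
lemma greatest_residue_even:
  assumes "p mod 4 = 1 \<or> p mod 8 = 7"
  obtains m where "0 < m" "m < p" "R m" "even m" "\<And>a. m < a \<Longrightarrow> a < p \<Longrightarrow> \<not> R a"
proof (cases "p mod 4 = 1")
  case True
  then show thesis
    using R_reflect[of 1] R_1 p_gt_2 odd_p by (intro that[of "p - 1"]) auto
next
  case False
  let ?q = "least_nonresidue"
  have q: "odd ?q" "0 < ?q" "?q < p"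
    using assms False odd_least_nonresidue R_2 least_nonresidue_pos least_nonresidue_less by auto
  show thesis
  proof (rule that[of "p - ?q"])
    show "R (p - ?q)" using R_reflect[of ?q] q False not_R_least by simp
    show "even (p - ?q)" using q odd_p by simp
    fix a assume a: "p - ?q < a" "a < p"
    then have "R (p - a)" using q by (intro R_below_least) auto
    then show "\<not> R a" using R_reflect[of a] a False by simp
  qed (use q in auto)
qed

section \<open>Gaps between consecutive residues\<close>

text \<open>
  If 2 is a residue, then the least nonresidue \<open>q\<close> lies between the residues \<open>q - 1\<close> and \<open>q + 1\<close>.
  Otherwise one of 1, 4, 7, 14 is a suitable \<open>a\<close>, depending on which of 3, 5, 7 are residues.
\<close>
lemma ex_residue_gap_2:
  assumes "p \<ge> 13"
  obtains a where "0 < a" "a + 2 < p" "R a" "\<not> R (a + 1)" "R (a + 2)"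
proof (cases "R 2")
  case True
  let ?q = "least_nonresidue"
  have "2 \<le> ?q" by (rule least_nonresidue_ge_2)
  with R_neighbours_of_least_nonresidue[OF True] not_R_least show thesis
    by (intro that[of "?q - 1"]) auto
next
  case n2: False
  have sq: "R 1" "R 4" "R 9" "R 16"
    using R_square[of 1] R_square[of 2] R_square[of 3] R_square[of 4] by simp_all
  show thesis
  proof (cases "R 3")
    case True
    with n2 sq(1) assms show thesis by (intro that[of 1]) (simp_all add: numeral_eq_Suc)
  next
    case n3: False
    \<comment> \<open>Modulo 13 the number 3 is the square of 4, so the remaining cases need only be
      considered for \<open>p > 16\<close>, where all numbers up to 16 are smaller than \<open>p\<close>.\<close>
    have "p \<noteq> 13"
    proof
      assume "p = 13"
      then have "R 16 \<longleftrightarrow> R 3" by (intro R_cong) (simp add: cong_def)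
      with sq n3 show False by simp
    qed
    moreover have "p \<noteq> 14" "p \<noteq> 16" using odd_p by auto
    moreover have "p \<noteq> 15"
      using prime_p by (auto simp: prime_nat_iff dest!: spec[of _ 3])
    ultimately have p: "p > 16" using assms by linarith
    have r6: "R 6" and n8: "\<not> R 8"
      using R_mult_less[of 2 3] R_mult_less[of 2 4] n2 n3 sq p by simp_all
    show thesis
    proof (cases "R 5")
      case False
      with sq(2) r6 p show thesis by (intro that[of 4]) simp_all
    next
      case r5: True
      have n15: "\<not> R 15" using R_mult_less[of 3 5] n3 r5 p by simp
      show thesis
      proof (cases "R 7")
        case True
        with n8 sq(3) p show thesis by (intro that[of 7]) simp_all
      next
        case n7: False
        have "R 14" using R_mult_less[of 2 7] n2 n7 p by simp
        with n15 sq(4) p show thesis by (intro that[of 14]) simp_all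
      qed
    qed
  qed
qed

text \<open>
  Let \<open>q\<close> be the least nonresidue. Since 2 is a residue, \<open>2 * q\<close> is a nonresidue and all even numbers
  strictly between \<open>q\<close> and \<open>2 * q\<close> are residues. If \<open>2 * q - 1\<close> is a residue, the run of residues
  that ends there begins after an odd nonresidue, so it has even length. If only \<open>2 * q + 1\<close> is
  a residue, then \<open>2 * q - 1, 2 * q\<close> is a run of nonresidues of even length. The
  remaining case forces \<open>q = 3\<close>: otherwise \<open>q\<close> is prime to 3, so one of \<open>2 * q - 1\<close> and \<open>2 * q + 1\<close>
  is 3 times a number below \<open>q\<close>, a product of two residues. Then 5 and 7 are nonresidues and 8, 9 is a
  run of residues between the nonresidues 7 and 10.
\<close>
lemma ex_odd_block:
  assumes p8: "p mod 8 = 7" and p7: "p > 7"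
  obtains a b where "0 < a" "a + 3 \<le> b" "b < p" "odd (b - a)" "R b \<longleftrightarrow> R a"
    "\<And>c. a < c \<Longrightarrow> c < b \<Longrightarrow> R c \<longleftrightarrow> \<not> R a"
proof -
  let ?q = "least_nonresidue"
  have p15: "p \<ge> 15" using p8 p7 by presburger
  have R2: "R 2" using p8 by (rule R_2)
  have "?q \<ge> 3" "odd ?q"
    using least_nonresidue_ge_2 odd_least_nonresidue[OF R2] by (auto simp: le_less)
  \<comment> \<open>All numbers that occur must be smaller than \<open>p\<close> for the rules of multiplication to apply.\<close>
  have bound: "2 * ?q + 1 < p"
  proof (cases "?q = 3")
    case False
    with \<open>?q \<ge> 3\<close> \<open>odd ?q\<close> have "?q \<ge> 5" by presburger
    then have "?q * 4 \<le> ?q * (?q - 1)" by simp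
    with least_nonresidue_bound \<open>?q \<ge> 5\<close> show ?thesis by linarith
  qed (use p15 in simp)
  have double: "R (2 * k) \<longleftrightarrow> R k" if "0 < k" "k < p" for k
    using R_mult_less[of 2 k] R2 that p_gt_2 by simp
  have "\<not> R (2 * ?q)"
    using double[of ?q] not_R_least least_nonresidue_pos least_nonresidue_less by simp
  show thesis
  proof (cases "R (2 * ?q - 1)")
    case True
    define l where "l = Max {c \<in> {?q..<2 * ?q}. \<not> R c}"
    have fin: "finite {c \<in> {?q..<2 * ?q}. \<not> R c}" and "?q \<in> {c \<in> {?q..<2 * ?q}. \<not> R c}"
      using not_R_least least_nonresidue_pos by auto
    then have l: "l \<in> {c \<in> {?q..<2 * ?q}. \<not> R c}"
      unfolding l_def using Max_in by blast
    have l_max: "R c" if "l < c" "c < 2 * ?q" for c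
    proof (rule ccontr)
      assume "\<not> R c"
      with that l have "c \<in> {c \<in> {?q..<2 * ?q}. \<not> R c}" by auto
      with fin have "c \<le> l" unfolding l_def by (rule Max_ge)
      with that show False by simp
    qed
    have "odd l"
    proof
      assume "even l"
      then obtain k where k: "l = 2 * k" by blast
      with l have "0 < k" "k < ?q" by auto
      then have "R l" using double[of k] R_below_least[of k] least_nonresidue_less k by simp
      with l show False by simp
    qed
    then obtain k where k: "l = 2 * k + 1" by (rule oddE)
    have "l \<noteq> 2 * ?q - 1" using l True by auto
    with k l have "k + 1 < ?q" by auto
    with k have "l + 3 \<le> 2 * ?q" by simp
    moreover have "odd (2 * ?q - l)" using \<open>odd l\<close> l by auto
    ultimately show thesis
      using l l_max \<open>\<not> R (2 * ?q)\<close> bound least_nonresidue_pos by (intro that[of l "2 * ?q"]) auto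
  next
    case n1: False
    have "2 * (?q - 1) = 2 * ?q - 2" by simp
    moreover have "R (2 * (?q - 1))"
      using double[of "?q - 1"] R_below_least[of "?q - 1"] \<open>?q \<ge> 3\<close> least_nonresidue_less by simp
    ultimately have before: "R (2 * ?q - 2)" by (simp only:)
    show thesis
    proof (cases "R (2 * ?q + 1)")
      case True
      show thesis
      proof (rule that[of "2 * ?q - 2" "2 * ?q + 1"])
        fix c assume "2 * ?q - 2 < c" "c < 2 * ?q + 1"
        then have "c = 2 * ?q - 1 \<or> c = 2 * ?q" by linarith
        then show "R c \<longleftrightarrow> \<not> R (2 * ?q - 2)"
          using before n1 \<open>\<not> R (2 * ?q)\<close> by blast
      next
        have "2 * ?q + 1 - (2 * ?q - 2) = 3" using \<open>?q \<ge> 3\<close> by simp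
        then show "odd (2 * ?q + 1 - (2 * ?q - 2))" by simp
      qed (use before True bound \<open>?q \<ge> 3\<close> in auto)
    next
      case n2: False
      have "?q = 3"
      proof (rule ccontr)
        assume "?q \<noteq> 3"
        with \<open>?q \<ge> 3\<close> have "?q > 3" by simp
        have times3: "R (3 * k)" if "0 < k" "k < ?q" for k
          using R_mult_less[of 3 k] R_below_least[of 3] R_below_least[of k] that \<open>?q > 3\<close>
            least_nonresidue_less by simp
        have "?q mod 3 = 0 \<or> ?q mod 3 = 1 \<or> ?q mod 3 = 2" by linarith
        then show False
        proof (elim disjE)
          assume "?q mod 3 = 0"
          then obtain k where "?q = 3 * k" by (metis mod_eq_0_iff_dvd dvd_def)
          with times3[of k] not_R_least least_nonresidue_pos show False by simp
        next
          assume "?q mod 3 = 1"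
          then have "\<exists>k. 2 * ?q + 1 = 3 * k" by presburger
          then obtain k where k: "2 * ?q + 1 = 3 * k" by blast
          then have "0 < k" "k < ?q" using \<open>?q > 3\<close> by auto
          then have "R (2 * ?q + 1)" unfolding k by (rule times3)
          with n2 show False ..
        next
          assume "?q mod 3 = 2"
          then have "\<exists>k. 2 * ?q - 1 = 3 * k" by presburger
          then obtain k where k: "2 * ?q - 1 = 3 * k" by blast
          then have "0 < k" "k < ?q" using \<open>?q > 3\<close> by auto
          then have "R (2 * ?q - 1)" unfolding k by (rule times3)
          with n1 show False ..
        qed
      qed
      with n1 n2 not_R_least have n: "\<not> R 3" "\<not> R 5" "\<not> R 7" by simp_all
      have n10: "\<not> R 10" and R8: "R 8" and R9: "R 9"
        using R_mult_less[of 2 5] R_mult_less[of 2 4] R_square[of 3] R_square[of 2] n R2 p15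
        by simp_all
      show thesis
      proof (rule that[of 7 10])
        fix c :: nat assume "7 < c" "c < 10"
        then have "c = 8 \<or> c = 9" by linarith
        then show "R c \<longleftrightarrow> \<not> R 7" using R8 R9 n by metis
      qed (use n n10 p15 in auto)
    qed
  qed
qed

text \<open>
  When the block consists of residues between nonresidues, reflection at \<open>p\<close> exchanges the roles.
\<close>
lemma ex_odd_residue_gap:
  assumes "p mod 8 = 7" "p > 7"
  obtains a b where "0 < a" "a + 3 \<le> b" "b < p" "odd (b - a)" "R a" "R b"
    "\<And>c. a < c \<Longrightarrow> c < b \<Longrightarrow> \<not> R c"
proof -
  obtain a b where ab: "0 < a" "a + 3 \<le> b" "b < p" "odd (b - a)" "R b \<longleftrightarrow> R a"
      and between: "\<And>c. a < c \<Longrightarrow> c < b \<Longrightarrow> R c \<longleftrightarrow> \<not> R a"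
    using ex_odd_block[OF assms] by blast
  show thesis
  proof (cases "R a")
    case True
    with ab between show thesis by (intro that[of a b]) auto
  next
    case False
    have p4: "p mod 4 \<noteq> 1" using assms(1) by presburger
    show thesis
    proof (rule that[of "p - b" "p - a"])
      show "R (p - a)" "R (p - b)"
        using R_reflect[of a] R_reflect[of b] ab False p4 by auto
      fix c assume c: "p - b < c" "c < p - a"
      then have "R (p - c)" using between[of "p - c"] False ab by auto
      with c R_reflect[of c] p4 show "\<not> R c" by auto
    next
      have "p - a - (p - b) = b - a" using ab by simp
      then show "odd (p - a - (p - b))" using ab(4) by simp
    qed (use ab in auto)
  qed
qed

text \<open>
  The map \<open>a \<mapsto> p - 1 - a\<close> exchanges the pairs \<open>a, a + 1\<close> of two residues with those of two nonresidues.
  Both kinds together are counted by the substitution \<open>a \<mapsto> (a + 1) / a\<close> modulo \<open>p\<close>, a bijection from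
  \<open>{1..p - 2}\<close> to \<open>{2..p - 1}\<close>: the quotient is a residue if and only if \<open>a\<close> and \<open>a + 1\<close> have the same
  character.
\<close>
lemma card_consecutive_residues:
  assumes p4: "p mod 4 = 3"
  shows "card {a \<in> {1..p - 2}. R a \<and> R (a + 1)} = (p - 3) div 4"
proof -
  define S where "S = {1..p - 2}"
  have S: "0 < a" "a + 1 < p" "a < p" if "a \<in> S" for a
    using that p_gt_2 by (auto simp: S_def)
  let ?RR = "{a \<in> S. R a \<and> R (a + 1)}" and ?NN = "{a \<in> S. \<not> R a \<and> \<not> R (a + 1)}"
    and ?E = "{a \<in> S. R a \<longleftrightarrow> R (a + 1)}"
  have reflect: "R (p - a) \<longleftrightarrow> \<not> R a" if "0 < a" "a < p" for a
    using R_reflect[OF that] p4 by simp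
  have "bij_betw (\<lambda>a. p - 1 - a) ?RR ?NN"
  proof (rule bij_betw_byWitness[where f' = "\<lambda>a. p - 1 - a"])
    have *: "p - 1 - a \<in> S" "R (p - 1 - a) \<longleftrightarrow> \<not> R (a + 1)" "R (p - 1 - a + 1) \<longleftrightarrow> \<not> R a"
        if "a \<in> S" for a
      using reflect[of a] reflect[of "a + 1"] S[OF that] that
      by (auto simp: S_def Suc_diff_Suc)
    show "(\<lambda>a. p - 1 - a) ` ?RR \<subseteq> ?NN" "(\<lambda>a. p - 1 - a) ` ?NN \<subseteq> ?RR"
      using * by auto
  qed (use S in force)+
  then have "card ?RR = card ?NN" by (rule bij_betw_same_card)
  moreover have "card ?E = card ?RR + card ?NN"
  proof -
    have "?E = ?RR \<union> ?NN" by auto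
    moreover have "card (?RR \<union> ?NN) = card ?RR + card ?NN"
      by (rule card_Un_disjoint) (auto simp: S_def)
    ultimately show ?thesis by (simp only:)
  qed
  moreover have "card ?E = (p - 1) div 2 - 1"
  proof -
    have "\<exists>x. [a * x = 1] (mod p)" if "a \<in> S" for a
    proof -
      have "coprime a p"
        using S[OF that] not_dvd[of a] prime_p by (metis coprime_commute prime_imp_coprime)
      then show ?thesis using cong_solve_coprime_nat[of a p] by simp
    qed
    then obtain i where i: "\<And>a. a \<in> S \<Longrightarrow> [a * i a = 1] (mod p)" by metis
    \<comment> \<open>\<open>i a\<close> is an inverse of \<open>a\<close>, so \<open>f a\<close> represents the quotient \<open>(a + 1) / a\<close>.\<close>
    define f where "f = (\<lambda>a. (a + 1) * i a mod p)"
    have f: "[a * f a = a + 1] (mod p)" if "a \<in> S" for a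
    proof -
      have "[a * f a = (a + 1) * (a * i a)] (mod p)"
        by (simp add: f_def cong_def mod_mult_right_eq ac_simps)
      moreover have "[(a + 1) * (a * i a) = (a + 1) * 1] (mod p)"
        using i[OF that] by (rule cong_scalar_left)
      ultimately show ?thesis using cong_trans by fastforce
    qed
    have f_less: "f a < p" for a using p_gt_2 by (simp add: f_def)
    have f_pos: "f a \<noteq> 0" if "a \<in> S" for a
    proof
      assume "f a = 0"
      with f[OF that] have "p dvd a + 1"
        by (simp add: cong_def mod_eq_0_iff_dvd)
      with S[OF that] not_dvd[of "a + 1"] show False by simp
    qed
    have f_ne1: "f a \<noteq> 1" if "a \<in> S" for a
    proof
      assume "f a = 1"
      with f[OF that] S[OF that] show False by (simp add: cong_def)
    qed
    have inj: "inj_on f S"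
    proof (rule inj_onI)
      fix a b assume ab: "a \<in> S" "b \<in> S" "f a = f b"
      have "[int (a * f a) = int (a + 1)] (mod int p)" "[int (b * f a) = int (b + 1)] (mod int p)"
        using f ab by (metis cong_int_iff)+
      then have "[int (a * f a) - int (b * f a) = int (a + 1) - int (b + 1)] (mod int p)"
        by (rule cong_diff)
      then have "int p dvd (int a - int b) * (int (f a) - 1)"
        by (simp add: cong_iff_dvd_diff algebra_simps)
      then have "int p dvd int a - int b \<or> int p dvd int (f a) - 1"
        using prime_p by (simp add: prime_dvd_mult_iff)
      moreover have "\<not> int p dvd int (f a) - 1"
        using f_pos[OF ab(1)] f_ne1[OF ab(1)] f_less[of a] by (intro zdvd_not_zless) auto
      ultimately have "[int a = int b] (mod int p)"
        by (simp add: cong_iff_dvd_diff)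
      then have "[a = b] (mod p)"
        by (simp add: cong_int_iff)
      then show "a = b"
        using S ab by (simp add: cong_def)
    qed
    have img: "f ` S = {2..p - 1}"
    proof (rule card_subset_eq)
      show "f ` S \<subseteq> {2..p - 1}"
      proof
        fix y assume "y \<in> f ` S"
        then obtain a where "a \<in> S" "y = f a" by blast
        then show "y \<in> {2..p - 1}"
          using f_pos[of a] f_ne1[of a] f_less[of a] by auto
      qed
      show "card (f ` S) = card {2..p - 1}"
        using card_image[OF inj] p_gt_2 by (simp add: S_def)
    qed simp
    have R_f: "R (f a) \<longleftrightarrow> (R a \<longleftrightarrow> R (a + 1))" if "a \<in> S" for a
      using R_cong[OF f[OF that]] R_mult_less[of a "f a"] S[OF that] f_pos[OF that] f_less[of a] by auto
    have "f ` ?E = {b \<in> f ` S. R b}"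
      using R_f by auto
    also have "\<dots> = {b \<in> {2..p - 1}. R b}"
      by (simp only: img)
    also have "\<dots> = {a \<in> {1..p - 1}. R a} - {1}"
      by auto
    finally have "f ` ?E = {a \<in> {1..p - 1}. R a} - {1}" .
    moreover have "card (f ` ?E) = card ?E"
      by (intro card_image inj_on_subset[OF inj]) auto
    moreover have "1 \<in> {a \<in> {1..p - 1}. R a}" using R_1 p_gt_2 by simp
    ultimately show ?thesis using card_R by simp
  qed
  ultimately have "2 * card ?RR = (p - 1) div 2 - 1" by simp
  then show ?thesis unfolding S_def by linarith
qed

end

section \<open>The parities of consecutive residues\<close>

lemma sorted_list_of_set_consecutive:
  fixes A :: "'a::linorder set"
  assumes A: "finite A" "a \<in> A" "b \<in> A" "a < b" and between: "\<And>c. a < c \<Longrightarrow> c < b \<Longrightarrow> c \<notin> A"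
  obtains n where "Suc n < card A" "sorted_list_of_set A ! n = a" "sorted_list_of_set A ! Suc n = b"
proof -
  let ?xs = "sorted_list_of_set A"
  have less: "?xs ! i < ?xs ! j" if "i < j" "j < card A" for i j
    using sorted_wrt_nth_less[OF strict_sorted_list_of_set that(1)] that(2) by simp
  obtain n where n: "n < card A" "?xs ! n = a"
    using A(1,2) by (metis in_set_conv_nth length_sorted_list_of_set set_sorted_list_of_set)
  obtain m where m: "m < card A" "?xs ! m = b"
    using A(1,3) by (metis in_set_conv_nth length_sorted_list_of_set set_sorted_list_of_set)
  have "n < m"
    using less[of m n] n m A(4) by (metis less_asym linorder_neqE_nat)
  have "\<not> Suc n < m"
  proof
    assume "Suc n < m"
    then have "a < ?xs ! Suc n" "?xs ! Suc n < b"
      using less[of n "Suc n"] less[of "Suc n" m] n m by auto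
    moreover have "?xs ! Suc n \<in> A"
      using \<open>Suc n < m\<close> m A(1) by (metis less_trans nth_mem length_sorted_list_of_set set_sorted_list_of_set)
    ultimately show False using between by blast
  qed
  with \<open>n < m\<close> have "m = Suc n" by simp
  with n m show thesis by (intro that[of n]) auto
qed

lemma sum_telescope_bit:
  fixes f :: "nat \<Rightarrow> nat"
  shows "(\<Sum>n<k. (of_nat (f n + f (n + 1)) :: bit)) = of_nat (f 0 + f k)"
proof (induction k)
  case (Suc k)
  have "(\<Sum>n<Suc k. (of_nat (f n + f (n + 1)) :: bit)) = of_nat (f 0 + f k) + of_nat (f k + f (k + 1))"
    using Suc.IH by (simp only: sum.lessThan_Suc)
  also have "\<dots> = of_nat (f 0 + f (Suc k))"
    by (cases "of_nat (f k) :: bit"; cases "of_nat (f 0) :: bit") simp_all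
  finally show ?case .
qed simp

context odd_prime
begin

lemma quad_residues_eq: "quad_residues p = {a. 0 < a \<and> a < p \<and> R a}"
  using p_gt_2 by (auto simp: quad_residues_def)

lemma finite_quad_residues: "finite (quad_residues p)"
  by (simp add: quad_residues_def)

text \<open>
  So the last index of the enumeration \<open>nth_residue p\<close> equals the period of the parity sequence.
\<close>
lemma card_quad_residues:
  assumes "p \<ge> 5"
  shows "card (quad_residues p) = (p - 3) div 2 + 1"
  using card_R assms by (simp add: quad_residues_def)

lemma nth_residue_mem:
  assumes "n < card (quad_residues p)"
  shows "nth_residue p n \<in> quad_residues p"
  using assms finite_quad_residues
  by (metis nth_residue_def nth_mem length_sorted_list_of_set set_sorted_list_of_set)

lemma nth_residue_less:
  assumes "i < j" "j < card (quad_residues p)"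
  shows "nth_residue p i < nth_residue p j"
  using sorted_wrt_nth_less[OF strict_sorted_list_of_set assms(1), of "quad_residues p"] assms(2)
  by (simp add: nth_residue_def)

lemma nth_residue_surj:
  assumes "a \<in> quad_residues p"
  obtains n where "n < card (quad_residues p)" "nth_residue p n = a"
  using assms finite_quad_residues
  by (metis in_set_conv_nth length_sorted_list_of_set nth_residue_def set_sorted_list_of_set)

lemma parity_seq_consecutive:
  assumes p5: "p \<ge> 5" and ab: "0 < a" "a < b" "b < p" "R a" "R b"
    and between: "\<And>c. a < c \<Longrightarrow> c < b \<Longrightarrow> \<not> R c"
  obtains n where "n < (p - 3) div 2" "nth_residue p n = a" "parity_seq p n = of_nat (a + b)"
proof -
  obtain n where n: "Suc n < card (quad_residues p)"
      "nth_residue p n = a" "nth_residue p (Suc n) = b"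
    unfolding nth_residue_def
    by (rule sorted_list_of_set_consecutive[OF finite_quad_residues, of a b])
      (use ab between in \<open>auto simp: quad_residues_eq\<close>)
  have "n < (p - 3) div 2"
    using n(1) card_quad_residues[OF p5] by simp
  moreover from this have "parity_seq p n = of_nat (a + b)"
    using n by (simp add: parity_seq_def)
  ultimately show thesis using n(2) that by blast
qed

text \<open>
  The sum telescopes to the parity of the first plus the last residue, where the first is 1
  and the last is even.
\<close>
lemma sum_parity_seq:
  assumes p5: "p \<ge> 5" and p: "p mod 4 = 1 \<or> p mod 8 = 7"
  shows "(\<Sum>n<(p - 3) div 2. parity_seq p n) = 1"
proof -
  let ?N = "(p - 3) div 2"
  have "(\<Sum>n<?N. parity_seq p n) = (\<Sum>n<?N. of_nat (nth_residue p n + nth_residue p (n + 1)))"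
    by (intro sum.cong) (auto simp: parity_seq_def)
  also have "\<dots> = of_nat (nth_residue p 0 + nth_residue p ?N)"
    by (rule sum_telescope_bit)
  also have "nth_residue p 0 = 1"
  proof -
    obtain i where i: "i < card (quad_residues p)" "nth_residue p i = 1"
      using nth_residue_surj[of 1] R_1 p_gt_2 by (auto simp: quad_residues_eq)
    have "nth_residue p 0 > 0"
      using nth_residue_mem[of 0] i(1) by (auto simp: quad_residues_eq)
    then show ?thesis
      using nth_residue_less[of 0 i] i by (cases "i = 0") auto
  qed
  also have "even (nth_residue p ?N)"
  proof -
    obtain m where m: "0 < m" "m < p" "R m" "even m" "\<And>a. m < a \<Longrightarrow> a < p \<Longrightarrow> \<not> R a"
      using greatest_residue_even[OF p] by blast
    obtain i where i: "i < card (quad_residues p)" "nth_residue p i = m"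
      using nth_residue_surj[of m] m by (auto simp: quad_residues_eq)
    have "i = ?N"
    proof (rule ccontr)
      assume "i \<noteq> ?N"
      with i(1) card_quad_residues[OF p5] have "i < ?N" by simp
      then have "m < nth_residue p ?N"
        using nth_residue_less[of i ?N] i(2) card_quad_residues[OF p5] by simp
      moreover have "nth_residue p ?N < p" "R (nth_residue p ?N)"
        using nth_residue_mem[of ?N] card_quad_residues[OF p5] by (auto simp: quad_residues_eq)
      ultimately show False using m(5) by blast
    qed
    with i m show ?thesis by simp
  qed
  then have "(of_nat (1 + nth_residue p ?N) :: bit) = 1"
    by (auto elim!: evenE)
  finally show ?thesis .
qed

text \<open>
  A gap of length 2 between consecutive residues gives a term 0.
\<close>
lemma zeros_of_parity_seq:
  assumes "p \<ge> 13"
  shows "card {n. n < (p - 3) div 2 \<and> parity_seq p n = 1} < (p - 3) div 2"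
proof -
  obtain a where a: "0 < a" "a + 2 < p" "R a" "\<not> R (a + 1)" "R (a + 2)"
    using ex_residue_gap_2[OF assms] by blast
  have between: "\<not> R c" if "a < c" "c < a + 2" for c
  proof -
    have "c = a + 1" using that by simp
    with a(4) show ?thesis by simp
  qed
  obtain n where n: "n < (p - 3) div 2" "parity_seq p n = of_nat (a + (a + 2))"
    using parity_seq_consecutive[of a "a + 2", OF _ a(1) _ a(2,3,5) between] assms by auto
  have "a + (a + 2) = 2 * (a + 1)" by simp
  then have "parity_seq p n = 0" using n(2) by (simp only: of_nat_mult) simp
  then have "card {n. n < (p - 3) div 2 \<and> parity_seq p n = 1} \<le> card ({..<(p - 3) div 2} - {n})"
    by (intro card_mono) auto
  moreover have "card ({..<(p - 3) div 2} - {n}) = (p - 3) div 2 - 1"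
    using n(1) by simp
  ultimately show ?thesis using n(1) by linarith
qed

text \<open>
  Every gap of length 1 gives a term 1, and so does a longer gap of odd length.
\<close>
lemma ones_of_parity_seq:
  assumes p8: "p mod 8 = 7" and p7: "p > 7"
  shows "(p - 3) div 4 < card {n. n < (p - 3) div 2 \<and> parity_seq p n = 1}"
proof -
  let ?O = "{n. n < (p - 3) div 2 \<and> parity_seq p n = 1}"
    and ?RR = "{a \<in> {1..p - 2}. R a \<and> R (a + 1)}"
  have p5: "p \<ge> 5" using p7 by simp
  obtain a b where ab: "0 < a" "a + 3 \<le> b" "b < p" "odd (b - a)" "R a" "R b"
      and between: "\<And>c. a < c \<Longrightarrow> c < b \<Longrightarrow> \<not> R c"
    using ex_odd_residue_gap[OF p8 p7] by blast
  have "a \<in> nth_residue p ` ?O"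
  proof -
    have "a < b" using ab by simp
    obtain n where n: "n < (p - 3) div 2" "nth_residue p n = a" "parity_seq p n = of_nat (a + b)"
      using parity_seq_consecutive[OF p5 ab(1) \<open>a < b\<close> ab(3,5,6) between] by blast
    moreover have "odd (a + b)" using ab by simp
    ultimately have "parity_seq p n = 1" by (auto elim!: oddE)
    with n show ?thesis by auto
  qed
  moreover have "c \<in> nth_residue p ` ?O" if "c \<in> ?RR" for c
  proof -
    have c: "0 < c" "c < c + 1" "c + 1 < p" "R c" "R (c + 1)"
      using that p_gt_2 by auto
    obtain n where n: "n < (p - 3) div 2" "nth_residue p n = c" "parity_seq p n = of_nat (c + (c + 1))"
      using parity_seq_consecutive[OF p5 c] by force
    moreover have "(of_nat (c + (c + 1)) :: bit) = 1"
      by (cases "of_nat c :: bit") simp_all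
    ultimately show ?thesis by auto
  qed
  ultimately have "insert a ?RR \<subseteq> nth_residue p ` ?O" by blast
  then have "card (insert a ?RR) \<le> card (nth_residue p ` ?O)"
    by (intro card_mono) auto
  also have "\<dots> \<le> card ?O" by (intro card_image_le) auto
  also have "card (insert a ?RR) = card ?RR + 1"
  proof -
    have "\<not> R (a + 1)" using between[of "a + 1"] ab(2) by simp
    then show ?thesis by (subst card_insert_disjoint) auto
  qed
  also have "card ?RR = (p - 3) div 4"
    using p8 by (intro card_consecutive_residues) presburger
  finally show ?thesis by simp
qed

end

section \<open>Maximality of the linear complexity\<close>

theorem theorem1:
  fixes p r s :: nat
  assumes "prime p"
    and "p = 2 ^ (s + 1) * r + 3"
    and "s \<in> {0, 1}"
    and "r = 1 \<or> (prime r \<and> odd r \<and> residue_primroot r 2)"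
  shows "linear_complexity (parity_seq p) = (p - 3) div 2"
proof -
  have r: "odd r" "r > 0"
    using assms(4) by (auto intro: prime_gt_0_nat)
  interpret odd_prime p
    using assms(1,2) by unfold_locales simp_all
  have p5: "p \<ge> 5"
    using assms(2,3) r(2) by auto
  define m :: nat where "m = 2 ^ s"
  have m: "m = 1 \<or> m = 2" and p_eq: "p = 2 * (m * r) + 3"
    using assms(2,3) by (auto simp: m_def)
  have N: "(p - 3) div 2 = m * r"
    using p_eq by simp
  \<comment> \<open>\<open>m = 1\<close> gives \<open>p = 2 * r + 3\<close> and \<open>m = 2\<close> gives \<open>p = 4 * r + 3\<close>, where \<open>r\<close> is odd.\<close>
  have p_mod: "p mod 4 = 1 \<or> p mod 8 = 7"
    using m p_eq r(1) by (auto elim!: oddE; presburger)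
  show ?thesis
    unfolding N
  proof (rule linear_complexity_eq_period_primroot[OF assms(4) m])
    show "parity_seq p (n + m * r) = parity_seq p n" for n
      by (simp add: parity_seq_def N)
    show "(\<Sum>n<m * r. parity_seq p n) = 1"
      using sum_parity_seq[OF p5 p_mod] by (simp only: N)
    assume "r \<noteq> 1"
    then have "r \<ge> 3" using r by presburger
    show "card {n. n < m * r \<and> parity_seq p n = 1} \<noteq> r"
      using m
    proof
      assume "m = 1"
      \<comment> \<open>The bound on \<open>p\<close> fails only for \<open>r = 3\<close>, where \<open>2 * r + 3\<close> is not prime.\<close>
      have "p \<noteq> 9"
        using prime_odd_nat prime_p by (auto simp: prime_nat_iff dest!: spec[of _ 3])
      then have "r \<noteq> 3" using p_eq \<open>m = 1\<close> by auto
      with \<open>r \<ge> 3\<close> r(1) have "r \<ge> 5" by presburger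
      then have "p \<ge> 13" using p_eq \<open>m = 1\<close> by simp
      then show ?thesis
        using zeros_of_parity_seq \<open>m = 1\<close> unfolding N by simp
    next
      assume "m = 2"
      have "p mod 8 = 7" "p > 7" "(p - 3) div 4 = r"
        using p_eq \<open>m = 2\<close> r(1) \<open>r \<ge> 3\<close> by (auto elim!: oddE)
      then show ?thesis
        using ones_of_parity_seq unfolding N by simp
    qed
  qed
qed

end
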